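(* The equation $(28^{n}-1)(49^{n}-1)=x^{2}$ in positive integers $n,x$ has only the solution $n=1$, $x=36$. *)

theory Defs
  imports Complex_Main
begin

end

theory Submission
  imports Defs "HOL-Number_Theory.Euler_Criterion" "HOL-Number_Theory.Pocklington"
    "HOL-Number_Theory.Mod_Exp"
begin

text \<open>
  Everything is decided by congruences on \<open>n\<close>.  For \<open>n \<ge> 2\<close> the factor \<open>28 ^ n - 1\<close> is
  \<open>-1\<close> modulo \<open>8\<close>, while \<open>49 ^ n - 1\<close> is \<open>16\<close> times a number congruent to \<open>3 * n\<close>
  modulo \<open>8\<close>.  Hence \<open>-3 * n\<close> is a square modulo \<open>8\<close>, and \<open>n\<close> is \<open>0\<close>, \<open>4\<close> or \<open>5\<close> modulo
  \<open>8\<close>.  This is where the solution \<open>n = 1\<close> disappears, because \<open>28 ^ 1\<close> is not divisible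
  by \<open>8\<close>; what is left can be excluded by looking at other primes.

  If \<open>4\<close> divides \<open>n\<close>, both factors are divisible by \<open>5\<close>.  The exponents of \<open>5\<close> in
  \<open>28 ^ 4 - 1\<close> and \<open>49 ^ 4 - 1\<close> are \<open>1\<close> and \<open>2\<close>, and raising to the power \<open>n / 4\<close> adds the
  same amount to both (lifting the exponent, lemma \<open>multiplicity_power_minus_one\<close>).  The
  product contains \<open>5\<close> to an odd power and is not a square.  No finite set of congruences
  would do here, since \<open>n = 0\<close> makes the product the square \<open>0\<close>.

  If \<open>n\<close> is \<open>5\<close> modulo \<open>8\<close>, then the prime \<open>17\<close>, modulo which \<open>28\<close> and \<open>49\<close> have orders
  dividing \<open>16\<close>, forces \<open>n\<close> to be \<open>5\<close> modulo \<open>16\<close>.  Modulo \<open>193\<close> the orders divide \<open>48\<close>,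
  and none of the classes \<open>5\<close>, \<open>21\<close>, \<open>37\<close> modulo \<open>48\<close> gives a quadratic residue.
\<close>

section \<open>Lifting the exponent at an odd prime\<close>

text \<open>
  With \<open>a = 1 + p * t\<close> the quotient \<open>(a ^ p - 1) / (a - 1)\<close> is the sum of the \<open>a ^ i\<close>, which
  modulo \<open>p\<^sup>2\<close> is \<open>p + p * t * (p * (p - 1) / 2)\<close>.  For odd \<open>p\<close> the second term vanishes
  modulo \<open>p\<^sup>2\<close>, and so \<open>p\<close> divides the quotient exactly once.
\<close>

lemma sum_powers_cong_prime_square:
  fixes a p :: int
  assumes "odd p" "p > 0" "[a = 1] (mod p)"
  shows "[(\<Sum>i<nat p. a ^ i) = p] (mod p\<^sup>2)"
proof -
  have "p dvd a - 1"
    using assms(3) by (simp add: cong_iff_dvd_diff)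
  then obtain t where t: "a = 1 + p * t"
    by (metis add.commute diff_add_cancel dvdE)
  have pow: "[a ^ i = 1 + int i * (p * t)] (mod p\<^sup>2)" for i
  proof (induction i)
    case (Suc i)
    have "[a ^ Suc i = (1 + p * t) * (1 + int i * (p * t))] (mod p\<^sup>2)"
      using cong_mult[OF cong_refl[of a] Suc] t by simp
    also have "(1 + p * t) * (1 + int i * (p * t)) =
        1 + int (Suc i) * (p * t) + p\<^sup>2 * (int i * t\<^sup>2)"
      by (simp add: algebra_simps power2_eq_square)
    also have "[1 + int (Suc i) * (p * t) + p\<^sup>2 * (int i * t\<^sup>2) = 1 + int (Suc i) * (p * t)] (mod p\<^sup>2)"
      by (simp add: cong_def)
    finally show ?case .
  qed simp
  obtain h where h: "p = 2 * h + 1"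
    using assms(1) by (elim oddE)
  have "(\<Sum>i<m. int i) * 2 = int m * (int m - 1)" for m
    by (induction m) (auto simp: algebra_simps)
  from this[of "nat p"] have half: "(\<Sum>i<nat p. int i) = p * h"
    using assms(2) h by simp
  have "[(\<Sum>i<nat p. a ^ i) = (\<Sum>i<nat p. 1 + int i * (p * t))] (mod p\<^sup>2)"
    by (intro cong_sum pow)
  also have "(\<Sum>i<nat p. 1 + int i * (p * t)) = p + (\<Sum>i<nat p. int i) * (p * t)"
    using assms(2) by (simp add: sum.distrib sum_distrib_right)
  also have "\<dots> = p + p\<^sup>2 * (h * t)"
    by (simp add: half power2_eq_square)
  also have "[p + p\<^sup>2 * (h * t) = p] (mod p\<^sup>2)"
    by (simp add: cong_def)
  finally show ?thesis .
qed

lemma multiplicity_power_prime_minus_one: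
  fixes a p :: int
  assumes "prime p" "odd p" "[a = 1] (mod p)" "a > 1"
  shows "multiplicity p (a ^ nat p - 1) = Suc (multiplicity p (a - 1))"
proof -
  define S where "S = (\<Sum>i<nat p. a ^ i)"
  have p: "p > 1"
    using assms(1) by (simp add: prime_gt_1_int)
  have S: "[S = p] (mod p\<^sup>2)"
    unfolding S_def using assms p by (intro sum_powers_cong_prime_square) auto
  have "p dvd S"
    using cong_dvd_modulus[OF S, of p] cong_dvd_iff[of S p p] by simp
  moreover have "\<not> p\<^sup>2 dvd S"
  proof
    assume "p\<^sup>2 dvd S"
    hence "p\<^sup>2 dvd p"
      using cong_dvd_iff[OF S] by simp
    thus False
      using p zdvd_imp_le[of "p\<^sup>2" p] by (simp add: power2_eq_square)
  qed
  ultimately have "multiplicity p S = 1"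
    by (intro multiplicity_eqI) (simp_all add: power2_eq_square)
  moreover have "S \<noteq> 0"
    using \<open>\<not> p\<^sup>2 dvd S\<close> by auto
  moreover have "a ^ nat p - 1 = (a - 1) * S"
    unfolding S_def by (rule power_diff_1_eq)
  ultimately show ?thesis
    using assms prime_elem_multiplicity_mult_distrib[of p "a - 1" S] prime_imp_prime_elem[of p]
    by simp
qed

text \<open>
  If \<open>p\<close> does not divide \<open>m\<close>, the quotient \<open>(a ^ m - 1) / (a - 1)\<close> is \<open>m\<close> modulo \<open>p\<close>, hence
  prime to \<open>p\<close>; each factor \<open>p\<close> of \<open>m\<close> contributes one by the previous lemma.
\<close>

lemma multiplicity_power_minus_one:
  fixes a p :: int
  assumes "prime p" "odd p" "[a = 1] (mod p)" "a > 1" "m > 0"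
  shows "multiplicity p (a ^ m - 1) = multiplicity p (a - 1) + multiplicity p (int m)"
  using assms
proof (induction m arbitrary: a rule: less_induct)
  case (less m)
  have p: "p > 1"
    using less.prems(1) by (simp add: prime_gt_1_int)
  show ?case
  proof (cases "p dvd int m")
    case False
    define S where "S = (\<Sum>i<m. a ^ i)"
    have "[S = (\<Sum>i<m. 1)] (mod p)"
      unfolding S_def using cong_pow[OF less.prems(3)] by (intro cong_sum) simp
    hence "\<not> p dvd S"
      using False by (simp add: cong_dvd_iff)
    moreover from this have "S \<noteq> 0"
      by auto
    moreover have "a ^ m - 1 = (a - 1) * S"
      unfolding S_def by (rule power_diff_1_eq)
    ultimately show ?thesis
      using less.prems False
        prime_elem_multiplicity_mult_distrib[of p "a - 1" S] prime_imp_prime_elem[of p]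
      by (simp add: not_dvd_imp_multiplicity_0)
  next
    case True
    then obtain k' where k': "int m = p * k'"
      by blast
    with p less.prems(5) have "k' > 0"
      by (metis of_nat_0_less_iff zero_less_mult_pos less_trans zero_less_one)
    define k where "k = nat k'"
    have k: "k > 0" "int m = p * int k"
      using \<open>k' > 0\<close> k' by (auto simp: k_def)
    have m: "m = nat p * k"
      using k(2) p by (metis nat_int nat_mult_distrib less_imp_le less_trans zero_less_one)
    have "k < m"
      using p k(1) m by simp
    moreover have "[a ^ nat p = 1] (mod p)"
      using cong_pow[OF less.prems(3), of "nat p"] by simp
    moreover have "a ^ nat p > 1"
      using less.prems(4) p by (intro one_less_power) auto
    ultimately have "multiplicity p ((a ^ nat p) ^ k - 1) =
        multiplicity p (a ^ nat p - 1) + multiplicity p (int k)"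
      using less.IH less.prems k(1) by blast
    also have "multiplicity p (a ^ nat p - 1) = Suc (multiplicity p (a - 1))"
      using less.prems by (intro multiplicity_power_prime_minus_one)
    also have "Suc (multiplicity p (a - 1)) + multiplicity p (int k) =
        multiplicity p (a - 1) + multiplicity p (int m)"
      using k p less.prems(1)
        prime_elem_multiplicity_mult_distrib[of p p "int k"] prime_imp_prime_elem[of p]
      by simp
    finally show ?thesis
      by (simp add: m power_mult)
  qed
qed

section \<open>Residue conditions on the exponent\<close>

lemma power_mod_period:
  fixes a q :: int
  assumes "a ^ k mod q = 1"
  shows "a ^ n mod q = a ^ (n mod k) mod q"
proof -
  have "[a ^ k = 1] (mod q)"
    using assms by (metis cong_def mod_mod_trivial)
  hence "[(a ^ k) ^ (n div k) * a ^ (n mod k) = 1 ^ (n div k) * a ^ (n mod k)] (mod q)"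
    by (intro cong_mult cong_pow cong_refl)
  thus ?thesis
    by (simp add: cong_def flip: power_mult power_add)
qed

lemma square_euler_criterion:
  fixes p :: nat and x :: int
  assumes "prime p" "2 < p"
  shows "\<not> [(x\<^sup>2) ^ ((p - 1) div 2) = -1] (mod p)"
proof
  assume minus_one: "[(x\<^sup>2) ^ ((p - 1) div 2) = -1] (mod p)"
  have "QuadRes p (x\<^sup>2)"
    unfolding QuadRes_def using cong_refl by blast
  hence "Legendre (x\<^sup>2) p \<in> {0, 1}"
    by (simp add: Legendre_def)
  moreover have "[Legendre (x\<^sup>2) p = -1] (mod p)"
    using cong_trans[OF euler_criterion[OF assms] minus_one] .
  hence "int p dvd Legendre (x\<^sup>2) p + 1"
    by (simp add: cong_iff_dvd_diff)
  ultimately show False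
    using assms(2) zdvd_imp_le[of "int p" 1] zdvd_imp_le[of "int p" 2] by auto
qed

lemma power_49_mod_128: "[49 ^ n = 1 + 48 * int n] (mod 128)"
proof (induction n)
  case (Suc n)
  have "[49 ^ Suc n = 49 * (1 + 48 * int n)] (mod 128)"
    using cong_mult[OF cong_refl[of 49] Suc] by simp
  also have "49 * (1 + 48 * int n) = 1 + 48 * int (Suc n) + 128 * (18 * int n)"
    by simp
  also have "[1 + 48 * int (Suc n) + 128 * (18 * int n) = 1 + 48 * int (Suc n)] (mod 128)"
    unfolding cong_def by (rule mod_mult_self2)
  finally show ?case .
qed simp

text \<open>
  Once the factor \<open>16\<close> of \<open>49 ^ n - 1\<close> is removed, the equation says modulo \<open>8\<close> that
  \<open>-3 * n\<close> is a square.
\<close>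

lemma exponent_mod_8:
  fixes x :: int
  assumes "(28 ^ n - 1) * (49 ^ n - 1) = x\<^sup>2" "n \<ge> 2"
  shows "n mod 8 \<in> {0, 4, 5}"
proof -
  have "(8::int) dvd 28\<^sup>2"
    by simp
  hence "(8::int) dvd 28 ^ n"
    using le_imp_power_dvd[OF assms(2), of "28::int"] by (rule dvd_trans)
  then obtain c where c: "(28::int) ^ n = 8 * c"
    by blast
  have "(128::int) dvd 49 ^ n - (1 + 48 * int n)"
    using power_49_mod_128[of n] by (simp add: cong_iff_dvd_diff)
  then obtain k where "(49::int) ^ n - (1 + 48 * int n) = 128 * k"
    by blast
  hence k: "(49::int) ^ n - 1 = 16 * (3 * int n + 8 * k)"
    by simp
  have x: "x\<^sup>2 = 16 * ((8 * c - 1) * (3 * int n + 8 * k))"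
    using assms(1) unfolding c k by (simp only: mult.left_commute)
  hence "4\<^sup>2 dvd x\<^sup>2"
    by simp
  hence "4 dvd x"
    using pow_divides_pow_iff[of 2 "4::int" x] by simp
  then obtain y where "x = 4 * y"
    by blast
  with x have "y\<^sup>2 = (8 * c - 1) * (3 * int n + 8 * k)"
    by (simp add: power_mult_distrib)
  also have "\<dots> = - 3 * int n + 8 * (c * (3 * int n + 8 * k) - k)"
    by (simp add: algebra_simps)
  finally have "y\<^sup>2 mod 8 = (- 3 * int n) mod 8"
    by (metis mod_mult_self2)
  moreover have "y\<^sup>2 mod 8 = (y mod 8)\<^sup>2 mod 8"
    by (simp add: power_mod)
  moreover have "y mod 8 \<in> {0..7}"
    by simp
  hence "y mod 8 \<in> set [0..7]"
    by (simp only: set_upto)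
  hence "(y mod 8)\<^sup>2 mod 8 \<in> {0, 1, 4}"
    by (auto simp: upto.simps)
  ultimately have "(- 3 * int n) mod 8 = 0 \<or> (- 3 * int n) mod 8 = 1 \<or> (- 3 * int n) mod 8 = 4"
    by simp
  hence "n mod 8 = 0 \<or> n mod 8 = 4 \<or> n mod 8 = 5"
    by presburger
  thus ?thesis
    by blast
qed

lemma not_square_if_4_dvd_exponent:
  fixes x :: int
  assumes "4 dvd n" "n > 0"
  shows "(28 ^ n - 1) * (49 ^ n - 1) \<noteq> x\<^sup>2"
proof
  assume eq: "(28 ^ n - 1) * (49 ^ n - 1) = x\<^sup>2"
  obtain m where m: "n = 4 * m" "m > 0"
    using assms by auto
  have "a ^ n > 1" if "a > 1" for a :: int
    using that assms(2) by (rule one_less_power)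
  from this[of 28] this[of 49] have nz: "(28::int) ^ n - 1 \<noteq> 0" "(49::int) ^ n - 1 \<noteq> 0"
    by simp_all
  have lift: "multiplicity 5 (a ^ n - 1) = multiplicity 5 (a ^ 4 - 1) + multiplicity 5 (int m)"
    if "[a ^ 4 = 1] (mod 5)" "a > 1" for a :: int
    using multiplicity_power_minus_one[of 5 "a ^ 4" m] that m one_less_power[of a 4]
    by (simp add: power_mult)
  have "multiplicity 5 ((28::int) ^ 4 - 1) = 1"
    by (intro multiplicity_eqI) auto
  moreover have "multiplicity 5 ((49::int) ^ 4 - 1) = 2"
    by (intro multiplicity_eqI) auto
  ultimately have "multiplicity 5 (((28::int) ^ n - 1) * (49 ^ n - 1)) =
      3 + 2 * multiplicity 5 (int m)"
    using nz lift[of 28] lift[of 49]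
    by (simp add: prime_elem_multiplicity_mult_distrib cong_def)
  moreover have "x \<noteq> 0"
    using eq nz by auto
  hence "multiplicity 5 (x\<^sup>2) = 2 * multiplicity 5 x"
    by (simp add: prime_elem_multiplicity_power_distrib)
  ultimately have "3 + 2 * multiplicity 5 (int m) = 2 * multiplicity 5 x"
    using eq by simp
  thus False
    by presburger
qed

text \<open>
  Here \<open>k\<close> is a common period of the powers of \<open>28\<close> and \<open>49\<close>, and the last hypothesis says
  that \<open>v\<close>, the value of the product modulo \<open>p\<close>, is a nonresidue by Euler's criterion.  The
  hypotheses use \<open>mod_exp\<close> so that for concrete numbers the simplifier reduces modulo \<open>p\<close>
  after every squaring and never forms the large powers.
\<close>

lemma not_square_if_nonresidue:
  fixes p :: nat and x v :: int
  assumes p: "prime p" "2 < p"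
    and period: "mod_exp 28 k (int p) = 1" "mod_exp 49 k (int p) = 1"
    and r: "n mod k = r"
    and v: "(mod_exp 28 r (int p) - 1) * (mod_exp 49 r (int p) - 1) mod int p = v"
    and nonresidue: "mod_exp v ((p - 1) div 2) (int p) = int p - 1"
  shows "(28 ^ n - 1) * (49 ^ n - 1) \<noteq> x\<^sup>2"
proof
  assume eq: "(28 ^ n - 1) * (49 ^ n - 1) = x\<^sup>2"
  have "[(28 ^ n - 1) * (49 ^ n - 1) =
      (mod_exp 28 r (int p) - 1) * (mod_exp 49 r (int p) - 1)] (mod p)"
    using power_mod_period[of 28 k "int p" n] power_mod_period[of 49 k "int p" n] period r
    by (intro cong_mult cong_diff cong_refl) (simp_all add: cong_def mod_exp_def)
  also have "[(mod_exp 28 r (int p) - 1) * (mod_exp 49 r (int p) - 1) = v] (mod p)"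
    using v by (auto simp: cong_def)
  finally have "[x\<^sup>2 = v] (mod p)"
    by (simp add: eq)
  hence "[(x\<^sup>2) ^ ((p - 1) div 2) = v ^ ((p - 1) div 2)] (mod p)"
    by (rule cong_pow)
  also have "[v ^ ((p - 1) div 2) = -1] (mod p)"
    using nonresidue p(2) by (simp add: cong_def zmod_minus1 mod_exp_def)
  finally show False
    using square_euler_criterion[OF p] by blast
qed

lemma prime_193: "prime (193::nat)"
  unfolding prime_divisor_sqrt
proof (intro conjI allI impI)
  fix d :: nat
  assume d: "d dvd 193 \<and> d\<^sup>2 \<le> 193"
  hence "d\<^sup>2 < 14\<^sup>2"
    by simp
  hence "d < 14"
    by (rule power_less_imp_less_base) simp
  moreover have "\<forall>d\<in>set [2..<14]. \<not> d dvd (193::nat)"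
    by code_simp
  ultimately have "d < 2"
    using d by (metis atLeastLessThan_iff not_less set_upt)
  moreover have "d \<noteq> 0"
    using d by (intro notI) auto
  ultimately show "d = 1"
    by simp
qed simp

lemma not_square_if_exponent_5_mod_8:
  fixes x :: int
  assumes "n mod 8 = 5"
  shows "(28 ^ n - 1) * (49 ^ n - 1) \<noteq> x\<^sup>2"
proof (cases "n mod 16 = 13")
  case True
  thus ?thesis
    by (intro not_square_if_nonresidue[where p = 17 and k = 16 and r = 13 and v = 6]) simp_all
next
  case False
  with assms have "n mod 16 = 5"
    by presburger
  hence "n mod 48 = 16 * (n div 16 mod 3) + 5"
    using mod_mult2_eq[of n 16 3] by simp
  moreover have "n div 16 mod 3 < 3"
    by simp
  hence "n div 16 mod 3 = 0 \<or> n div 16 mod 3 = 1 \<or> n div 16 mod 3 = 2"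
    by linarith
  ultimately consider "n mod 48 = 5" | "n mod 48 = 21" | "n mod 48 = 37"
    by auto
  thus ?thesis
  proof cases
    case 1
    show ?thesis
      by (rule not_square_if_nonresidue[OF prime_193 _ _ _ 1, where v = 180])
        simp_all
  next
    case 2
    show ?thesis
      by (rule not_square_if_nonresidue[OF prime_193 _ _ _ 2, where v = 76])
        simp_all
  next
    case 3
    show ?thesis
      by (rule not_square_if_nonresidue[OF prime_193 _ _ _ 3, where v = 133])
        simp_all
  qed
qed

section \<open>The equation\<close>

theorem corollary14:
  fixes n :: nat and x :: int
  shows "n > 0 \<and> x > 0 \<and> (28 ^ n - 1) * (49 ^ n - 1) = x ^ 2 \<longleftrightarrow> n = 1 \<and> x = 36"
proof
  assume sol: "n > 0 \<and> x > 0 \<and> (28 ^ n - 1) * (49 ^ n - 1) = x ^ 2"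
  have "n = 1"
  proof (rule ccontr)
    assume "n \<noteq> 1"
    with sol have "n mod 8 \<in> {0, 4, 5}"
      by (intro exponent_mod_8[of n x]) auto
    hence "n mod 8 = 0 \<or> n mod 8 = 4 \<or> n mod 8 = 5"
      by blast
    hence "4 dvd n \<or> n mod 8 = 5"
      by presburger
    thus False
      using sol not_square_if_4_dvd_exponent not_square_if_exponent_5_mod_8 by blast
  qed
  moreover from this sol have "x\<^sup>2 = 36\<^sup>2"
    by simp
  hence "x = 36"
    using sol power2_eq_iff_nonneg[of x 36] by simp
  ultimately show "n = 1 \<and> x = 36"
    by simp
qed auto

end
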